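(* Let $R$ be a local ring and let $\mathcal C$ be the full subcategory of $\operatorname{Mod-}R$ whose objects are the modules $R/rR$ with $r\in J(R)\setminus\{0\}$. Let $\{U_i\mid i\in I\}$ and $\{V_j\mid j\in J\}$ be families of right $R$-modules in $\mathcal C$. Suppose there exist bijections $\sigma,\tau\colon I\to J$ such that $[U_i]_l=[V_{\sigma(i)}]_l$ and $[U_i]_e=[V_{\tau(i)}]_e$ for every $i\in I$. Then $\prod_{i\in I}U_i\cong\prod_{j\in J}V_j$.
   Context: $J(R)$ is the Jacobson radical and $U(R)$ the group of units. For $r,s\in J(R)\setminus\{0\}$, $R/rR$ and $R/sR$ have the same lower part, written $[R/rR]_l=[R/sR]_l$, if there exist $u,v\in U(R)$ and $x,y\in R$ with $ru=xs$ and $sv=yr$. $[M]_e=[N]_e$ (same epigeny class) means there exist epimorphisms $M\to N$ and $N\to M$. *)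

theory Defs
  imports Main "HOL-Library.FuncSet"
begin

definition ring_units :: "'a::ring_1 set" where
  "ring_units = {u. \<exists>v. u * v = 1 \<and> v * u = 1}"

definition right_ideal :: "'a::ring_1 set \<Rightarrow> bool" where
  "right_ideal K \<longleftrightarrow> 0 \<in> K \<and> (\<forall>x\<in>K. \<forall>y\<in>K. x + y \<in> K) \<and> (\<forall>x\<in>K. - x \<in> K)
      \<and> (\<forall>x\<in>K. \<forall>a. x * a \<in> K)"

definition maximal_right_ideal :: "'a::ring_1 set \<Rightarrow> bool" where
  "maximal_right_ideal K \<longleftrightarrow> right_ideal K \<and> K \<noteq> UNIV
      \<and> (\<forall>L. right_ideal L \<and> K \<subseteq> L \<and> L \<noteq> UNIV \<longrightarrow> L = K)"

definition jacobson :: "'a::ring_1 set" where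
  "jacobson = \<Inter> {K. maximal_right_ideal K}"

definition local_ring :: "'a::ring_1 itself \<Rightarrow> bool" where
  "local_ring _ \<longleftrightarrow> (\<exists>!K::'a set. maximal_right_ideal K)"

text \<open>Same lower part: [R/rR]_l = [R/sR]_l.\<close>
definition same_lower_part :: "'a::ring_1 \<Rightarrow> 'a \<Rightarrow> bool" where
  "same_lower_part r s \<longleftrightarrow> (\<exists>u\<in>ring_units. \<exists>v\<in>ring_units. \<exists>x y. r * u = x * s \<and> s * v = y * r)"

record ('m, 'r) rmodule =
  mcarrier :: "'m set"
  madd :: "'m \<Rightarrow> 'm \<Rightarrow> 'm"
  msmult :: "'m \<Rightarrow> 'r \<Rightarrow> 'm"

definition rmod_hom :: "('m, 'r) rmodule \<Rightarrow> ('n, 'r) rmodule \<Rightarrow> ('m \<Rightarrow> 'n) \<Rightarrow> bool" where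
  "rmod_hom M N f \<longleftrightarrow> f \<in> mcarrier M \<rightarrow> mcarrier N
     \<and> (\<forall>x\<in>mcarrier M. \<forall>y\<in>mcarrier M. f (madd M x y) = madd N (f x) (f y))
     \<and> (\<forall>x\<in>mcarrier M. \<forall>a. f (msmult M x a) = msmult N (f x) a)"

definition rmod_epi :: "('m, 'r) rmodule \<Rightarrow> ('n, 'r) rmodule \<Rightarrow> ('m \<Rightarrow> 'n) \<Rightarrow> bool" where
  "rmod_epi M N f \<longleftrightarrow> rmod_hom M N f \<and> f ` mcarrier M = mcarrier N"

definition rmod_iso_exists :: "('m, 'r) rmodule \<Rightarrow> ('n, 'r) rmodule \<Rightarrow> bool" where
  "rmod_iso_exists M N \<longleftrightarrow> (\<exists>f. rmod_hom M N f \<and> bij_betw f (mcarrier M) (mcarrier N))"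

definition same_epigeny :: "('m, 'r) rmodule \<Rightarrow> ('n, 'r) rmodule \<Rightarrow> bool" where
  "same_epigeny M N \<longleftrightarrow> (\<exists>f. rmod_epi M N f) \<and> (\<exists>g. rmod_epi N M g)"

definition rcoset :: "'a::ring_1 \<Rightarrow> 'a \<Rightarrow> 'a set" where
  "rcoset r x = {x + r * y | y. True}"

definition cyc_module :: "'a::ring_1 \<Rightarrow> ('a set, 'a) rmodule" where
  "cyc_module r = \<lparr> mcarrier = {rcoset r x | x. True},
      madd = (\<lambda>A B. {a + b | a b. a \<in> A \<and> b \<in> B}),
      msmult = (\<lambda>A c. {a * c + r * y | a y. a \<in> A}) \<rparr>"

definition prod_module :: "'i set \<Rightarrow> ('i \<Rightarrow> ('m, 'r) rmodule) \<Rightarrow> ('i \<Rightarrow> 'm, 'r) rmodule" where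
  "prod_module I M = \<lparr> mcarrier = PiE I (\<lambda>i. mcarrier (M i)),
      madd = (\<lambda>f g. \<lambda>i\<in>I. madd (M i) (f i) (g i)),
      msmult = (\<lambda>f a. \<lambda>i\<in>I. msmult (M i) (f i) a) \<rparr>"

end

theory Submission
  imports Defs
begin

text \<open>If \<open>A\<close> has the lower part of \<open>B\<close> and the epigeny class of \<open>C\<close>, then \<open>A \<oplus> D \<cong> B \<oplus> C\<close>
  for some \<open>D\<close> with the lower part of \<open>C\<close> and the epigeny class of \<open>B\<close> (exchange). Identify
  \<open>J\<close> with \<open>I\<close> along \<open>\<sigma>\<close> and split \<open>I\<close> into the orbits of \<open>\<sigma>\<inverse>\<tau>\<close>. On a finite orbit, exchange allows
  induction on the number of factors. On an infinite orbit, indexed by the integers, \<open>U\<^sub>n\<close> has the lower part of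
  \<open>V\<^sub>n\<close> and the epigeny class of \<open>V\<^bsub>n+1\<^esub>\<close>; exchanging alternately against pairs of \<open>V\<close>'s and pairs of
  \<open>U\<close>'s while moving outwards from \<open>U\<^sub>0\<close> gives a sequence whose product is isomorphic to both sides.\<close>

section \<open>Local rings\<close>

lemma right_ideal_chain_Union:
  assumes "C \<noteq> {}" "\<And>K. K \<in> C \<Longrightarrow> right_ideal K"
    and chain: "\<And>K L. K \<in> C \<Longrightarrow> L \<in> C \<Longrightarrow> K \<subseteq> L \<or> L \<subseteq> K"
  shows "right_ideal (\<Union>C)"
  unfolding right_ideal_def
proof (intro conjI ballI allI)
  show "0 \<in> \<Union>C" using assms(1,2) unfolding right_ideal_def by blast
next
  fix x y assume "x \<in> \<Union>C" "y \<in> \<Union>C"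
  then obtain K L where "K \<in> C" "L \<in> C" "x \<in> K" "y \<in> L" by blast
  then obtain M where "M \<in> C" "x \<in> M" "y \<in> M" using chain by blast
  then show "x + y \<in> \<Union>C" using assms(2) unfolding right_ideal_def by blast
next
  fix x assume "x \<in> \<Union>C"
  then show "- x \<in> \<Union>C" using assms(2) unfolding right_ideal_def by blast
next
  fix x a assume "x \<in> \<Union>C"
  then show "x * a \<in> \<Union>C" using assms(2) unfolding right_ideal_def by blast
qed

lemma right_ideal_eq_UNIV_iff:
  assumes "right_ideal K"
  shows "K = UNIV \<longleftrightarrow> 1 \<in> K"
  using assms unfolding right_ideal_def by (metis UNIV_I UNIV_eq_I mult_1)

lemma proper_right_ideal_subset_maximal:
  assumes "right_ideal (K :: 'a::ring_1 set)" "K \<noteq> UNIV"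
  shows "\<exists>M. maximal_right_ideal M \<and> K \<subseteq> M"
proof -
  \<comment> \<open>Properness is encoded as \<open>1 \<notin> L\<close>, a condition that visibly
    passes to unions of chains.\<close>
  define A where "A = {L :: 'a set. right_ideal L \<and> K \<subseteq> L \<and> 1 \<notin> L}"
  have "\<exists>M\<in>A. \<forall>X\<in>A. M \<subseteq> X \<longrightarrow> X = M"
  proof (rule subset_Zorn_nonempty)
    show "A \<noteq> {}" using assms right_ideal_eq_UNIV_iff unfolding A_def by blast
  next
    fix C assume C: "C \<noteq> {}" "subset.chain A C"
    have "right_ideal (\<Union>C)"
      by (rule right_ideal_chain_Union) (use C in \<open>auto simp: A_def subset_chain_def\<close>)
    then show "\<Union>C \<in> A" using C by (auto simp: A_def subset_chain_def)
  qed
  then obtain M where "M \<in> A" "\<forall>X\<in>A. M \<subseteq> X \<longrightarrow> X = M" by blast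
  then show ?thesis
    unfolding maximal_right_ideal_def A_def using right_ideal_eq_UNIV_iff
    by (smt (verit, ccfv_SIG) mem_Collect_eq subset_trans)
qed

lemma right_ideal_principal: "right_ideal (range ((*) (x :: 'a::ring_1)))"
  unfolding right_ideal_def
proof (intro conjI ballI allI)
  show "0 \<in> range ((*) x)" by (metis mult_zero_right rangeI)
  show "a + b \<in> range ((*) x)" if "a \<in> range ((*) x)" "b \<in> range ((*) x)" for a b
    using that by (auto simp: distrib_left[symmetric])
  show "- a \<in> range ((*) x)" if "a \<in> range ((*) x)" for a
    using that by (auto simp: mult_minus_right[symmetric] simp del: mult_minus_right)
  show "a * b \<in> range ((*) x)" if "a \<in> range ((*) x)" for a b
    using that by (auto simp: mult.assoc)
qed

lemma local_ring_jacobson: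
  assumes "local_ring TYPE('a::ring_1)"
  shows "maximal_right_ideal (jacobson :: 'a set)"
    and "maximal_right_ideal K \<Longrightarrow> K = (jacobson :: 'a set)"
proof -
  obtain M :: "'a set" where M: "{K. maximal_right_ideal K} = {M}"
    using assms unfolding local_ring_def by blast
  then have "jacobson = M" unfolding jacobson_def by simp
  then show "maximal_right_ideal (jacobson :: 'a set)"
    and "maximal_right_ideal K \<Longrightarrow> K = (jacobson :: 'a set)" using M by auto
qed

lemma jacobson_right_ideal:
  assumes "local_ring TYPE('a::ring_1)"
  shows "right_ideal (jacobson :: 'a set)" "1 \<notin> (jacobson :: 'a set)"
  using local_ring_jacobson(1)[OF assms] right_ideal_eq_UNIV_iff
  unfolding maximal_right_ideal_def by blast+

text \<open>If \<open>x\<close> had no right inverse, the right ideal generated by \<open>x\<close>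
  would be proper and so lie in the only maximal right ideal, which is
  \<open>jacobson\<close>.\<close>

lemma right_inverse_if_not_jacobson:
  assumes "local_ring TYPE('a::ring_1)" "(x::'a) \<notin> jacobson"
  shows "\<exists>y. x * y = 1"
proof (rule ccontr)
  assume "\<nexists>y. x * y = 1"
  then have "1 \<notin> range ((*) x)" by (metis imageE)
  then obtain M where "maximal_right_ideal M" "range ((*) x) \<subseteq> M"
    using proper_right_ideal_subset_maximal[OF right_ideal_principal[of x]] by blast
  then show False using local_ring_jacobson(2)[OF assms(1)] assms(2)
    by (metis mult.right_neutral rangeI subsetD)
qed

text \<open>Outside \<open>jacobson\<close> only right inverses are given. If the right inverse
  \<open>y\<close> of \<open>x\<close> is again outside, then \<open>y\<close> has a right inverse
  too, and this must be \<open>x\<close>.\<close>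

lemma local_ring_units_iff:
  assumes "local_ring TYPE('a::ring_1)"
  shows "(x::'a) \<in> ring_units \<longleftrightarrow> x \<notin> jacobson"
proof
  have J: "right_ideal (jacobson :: 'a set)" "1 \<notin> (jacobson :: 'a set)"
    by (rule jacobson_right_ideal[OF assms])+
  assume "x \<in> ring_units"
  then obtain y where "x * y = 1" unfolding ring_units_def by blast
  moreover have "x * y \<in> jacobson" if "x \<in> jacobson" using that J(1) unfolding right_ideal_def by blast
  ultimately show "x \<notin> jacobson" using J(2) by auto
next
  have J: "right_ideal (jacobson :: 'a set)" "1 \<notin> (jacobson :: 'a set)"
    by (rule jacobson_right_ideal[OF assms])+
  assume x: "x \<notin> jacobson"
  then obtain y where xy: "x * y = 1" using right_inverse_if_not_jacobson[OF assms] by blast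
  have "y \<notin> jacobson"
  proof
    assume "y \<in> jacobson"
    then have yx: "y * x \<in> jacobson" using J unfolding right_ideal_def by blast
    \<comment> \<open>With \<open>y * x\<close> in \<open>jacobson\<close>, the element
      \<open>1 - y * x\<close> is right invertible. But \<open>x\<close> annihilates it from the
      left since \<open>x * y = 1\<close>, which forces \<open>x = 0\<close>.\<close>
    have "1 - y * x \<notin> jacobson"
    proof
      assume "1 - y * x \<in> jacobson"
      then have "(1 - y * x) + y * x \<in> jacobson" using yx J unfolding right_ideal_def by blast
      then show False using J by simp
    qed
    then obtain t where "(1 - y * x) * t = 1" using right_inverse_if_not_jacobson[OF assms] by blast
    then have "x = x * ((1 - y * x) * t)" by simp
    also have "\<dots> = (x - (x * y) * x) * t" by (simp add: algebra_simps)
    also have "\<dots> = 0" using xy by simp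
    finally show False using x J unfolding right_ideal_def by blast
  qed
  then obtain z where yz: "y * z = 1" using right_inverse_if_not_jacobson[OF assms] by blast
  have "x = z" using xy yz by (metis mult.assoc mult.left_neutral mult.right_neutral)
  then show "x \<in> ring_units" using xy yz unfolding ring_units_def by blast
qed

lemma unit_one: "1 \<in> ring_units"
  unfolding ring_units_def by auto

lemma unit_mult:
  assumes "u \<in> ring_units" "v \<in> ring_units"
  shows "u * v \<in> ring_units"
proof -
  obtain u' v' where "u * u' = 1" "u' * u = 1" "v * v' = 1" "v' * v = 1"
    using assms unfolding ring_units_def by blast
  then have "(u * v) * (v' * u') = 1" "(v' * u') * (u * v) = 1"
    by (metis mult.assoc mult.right_neutral)+
  then show ?thesis unfolding ring_units_def by blast
qed

lemma unit_inverse: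
  assumes "u \<in> ring_units"
  obtains u' where "u' \<in> ring_units" "u * u' = 1" "u' * u = 1"
  using assms unfolding ring_units_def by blast

lemma unit_add_nonunit:
  assumes "local_ring TYPE('a::ring_1)" "(u::'a) \<in> ring_units" "x \<notin> ring_units"
  shows "u + x \<in> ring_units"
proof (rule ccontr)
  assume "u + x \<notin> ring_units"
  then have "(u + x) + - x \<in> jacobson"
    using assms jacobson_right_ideal(1)[OF assms(1)] local_ring_units_iff[OF assms(1)]
    unfolding right_ideal_def by blast
  then show False using assms local_ring_units_iff[OF assms(1)] by simp
qed

text \<open>Nonunits form a right ideal, so a unit product has a unit left factor, which can be
  cancelled. Hence multiples of nonunits on either side are nonunits.\<close>

lemma unit_mult_iff:
  assumes "local_ring TYPE('a::ring_1)"
  shows "(x::'a) * y \<in> ring_units \<longleftrightarrow> x \<in> ring_units \<and> y \<in> ring_units"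
proof
  assume xy: "x * y \<in> ring_units"
  then have x: "x \<in> ring_units"
    using jacobson_right_ideal(1)[OF assms] local_ring_units_iff[OF assms]
    unfolding right_ideal_def by blast
  then obtain x' where "x' \<in> ring_units" "x' * x = 1" using unit_inverse by blast
  then have "y = x' * (x * y)" by (simp add: mult.assoc[symmetric])
  then show "x \<in> ring_units \<and> y \<in> ring_units"
    using x xy \<open>x' \<in> ring_units\<close> unit_mult by metis
qed (simp add: unit_mult)

section \<open>Lower parts and epigeny classes\<close>

text \<open>Elementwise form of the epigeny class: a unit \<open>u\<close> with \<open>u * r\<close>
  in \<open>s R\<close> makes left multiplication by \<open>u\<close> an epimorphism from
  \<open>R/rR\<close> onto \<open>R/sR\<close>. It mirrors \<open>same_lower_part\<close> with the
  sides exchanged.\<close>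

definition same_epi_class :: "'a::ring_1 \<Rightarrow> 'a \<Rightarrow> bool" where
  "same_epi_class r s \<longleftrightarrow> (\<exists>u\<in>ring_units. \<exists>v\<in>ring_units. \<exists>x y. u * r = s * x \<and> v * s = r * y)"

lemma same_lower_part_refl: "same_lower_part r r"
  unfolding same_lower_part_def using unit_one by (metis mult_1 mult_1_right)

lemma same_lower_part_sym: "same_lower_part r s \<Longrightarrow> same_lower_part s r"
  unfolding same_lower_part_def by blast

lemma same_lower_part_trans:
  assumes "same_lower_part r s" "same_lower_part s t"
  shows "same_lower_part r t"
proof -
  obtain u v x y where 1: "u \<in> ring_units" "v \<in> ring_units" "r * u = x * s" "s * v = y * r"
    using assms(1) unfolding same_lower_part_def by blast
  obtain u' v' x' y' where 2: "u' \<in> ring_units" "v' \<in> ring_units" "s * u' = x' * t" "t * v' = y' * s"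
    using assms(2) unfolding same_lower_part_def by blast
  have "r * (u * u') = (x * x') * t" "t * (v' * v) = (y' * y) * r"
    using 1 2 by (metis mult.assoc)+
  then show ?thesis
    unfolding same_lower_part_def using unit_mult[OF 1(1) 2(1)] unit_mult[OF 2(2) 1(2)] by blast
qed

lemma same_epi_class_refl: "same_epi_class r r"
  unfolding same_epi_class_def using unit_one by (metis mult_1 mult_1_right)

lemma same_epi_class_sym: "same_epi_class r s \<Longrightarrow> same_epi_class s r"
  unfolding same_epi_class_def by blast

lemma same_epi_class_trans:
  assumes "same_epi_class r s" "same_epi_class s t"
  shows "same_epi_class r t"
proof -
  obtain u v x y where 1: "u \<in> ring_units" "v \<in> ring_units" "u * r = s * x" "v * s = r * y"
    using assms(1) unfolding same_epi_class_def by blast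
  obtain u' v' x' y' where 2: "u' \<in> ring_units" "v' \<in> ring_units" "u' * s = t * x'" "v' * t = s * y'"
    using assms(2) unfolding same_epi_class_def by blast
  have "(u' * u) * r = t * (x' * x)" "(v * v') * t = r * (y * y')"
    using 1 2 by (metis mult.assoc)+
  then show ?thesis
    unfolding same_epi_class_def using unit_mult[OF 2(1) 1(1)] unit_mult[OF 1(2) 2(2)] by blast
qed

lemma unit_equivalent_imp_same:
  assumes "u \<in> ring_units" "v \<in> ring_units" "u * r = s * v"
  shows "same_lower_part r s" "same_epi_class r s"
proof -
  obtain u' where u': "u' \<in> ring_units" "u * u' = 1" "u' * u = 1" using assms(1) unit_inverse by blast
  obtain v' where v': "v' \<in> ring_units" "v * v' = 1" "v' * v = 1" using assms(2) unit_inverse by blast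
  have 1: "u' * s = r * v'"
    using assms(3) u' v' by (metis mult.assoc mult_1 mult_1_right)
  have 2: "r * v' = u' * s" "s * v = u * r" using 1 assms by auto
  show "same_lower_part r s" unfolding same_lower_part_def using 2 v' assms by blast
  show "same_epi_class r s" unfolding same_epi_class_def using 1 assms u' by blast
qed

section \<open>Isomorphisms of products through free products\<close>

text \<open>The product of the \<open>R/r\<^sub>iR\<close> is the quotient of the free product by \<open>cong_mod I r\<close>;
  homomorphisms are represented by maps of the free products that are linear modulo this congruence.
  Since \<open>cong_mod I r\<close> ignores coordinates outside \<open>I\<close>, no restrictions are needed when
  such maps are glued.\<close>

definition cong_mod :: "'i set \<Rightarrow> ('i \<Rightarrow> 'a::ring_1) \<Rightarrow> ('i \<Rightarrow> 'a) \<Rightarrow> ('i \<Rightarrow> 'a) \<Rightarrow> bool" where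
  "cong_mod I r x y \<longleftrightarrow> (\<forall>i\<in>I. \<exists>k. y i = x i + r i * k)"

definition lift_hom ::
  "'i set \<Rightarrow> ('i \<Rightarrow> 'a::ring_1) \<Rightarrow> 'j set \<Rightarrow> ('j \<Rightarrow> 'a) \<Rightarrow> (('i \<Rightarrow> 'a) \<Rightarrow> 'j \<Rightarrow> 'a) \<Rightarrow> bool" where
  "lift_hom I r J s \<Phi> \<longleftrightarrow>
     (\<forall>x y. cong_mod I r x y \<longrightarrow> cong_mod J s (\<Phi> x) (\<Phi> y)) \<and>
     (\<forall>x y. cong_mod J s (\<Phi> (\<lambda>i. x i + y i)) (\<lambda>j. \<Phi> x j + \<Phi> y j)) \<and>
     (\<forall>x c. cong_mod J s (\<Phi> (\<lambda>i. x i * c)) (\<lambda>j. \<Phi> x j * c))"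

definition fam_iso :: "'i set \<Rightarrow> ('i \<Rightarrow> 'a::ring_1) \<Rightarrow> 'j set \<Rightarrow> ('j \<Rightarrow> 'a) \<Rightarrow> bool" where
  "fam_iso I r J s \<longleftrightarrow> (\<exists>\<Phi> \<Psi>. lift_hom I r J s \<Phi> \<and> lift_hom J s I r \<Psi> \<and>
     (\<forall>x. cong_mod I r (\<Psi> (\<Phi> x)) x) \<and> (\<forall>y. cong_mod J s (\<Phi> (\<Psi> y)) y))"

lemma cong_mod_refl: "cong_mod I r x x"
  unfolding cong_mod_def by (metis add.right_neutral mult_zero_right)

lemma cong_mod_eqI: "(\<And>i. i \<in> I \<Longrightarrow> x i = y i) \<Longrightarrow> cong_mod I r x y"
  unfolding cong_mod_def by (metis add.right_neutral mult_zero_right)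

lemma cong_mod_trans:
  assumes "cong_mod I r x y" "cong_mod I r y z" shows "cong_mod I r x z"
  unfolding cong_mod_def
proof
  fix i assume "i \<in> I"
  then obtain k l where "y i = x i + r i * k" "z i = y i + r i * l"
    using assms unfolding cong_mod_def by blast
  then have "z i = x i + r i * (k + l)" by (simp add: algebra_simps)
  then show "\<exists>k. z i = x i + r i * k" by blast
qed

lemma fam_isoI:
  assumes "lift_hom I r J s \<Phi>" "lift_hom J s I r \<Psi>"
    and "\<And>x i. i \<in> I \<Longrightarrow> \<Psi> (\<Phi> x) i = x i" "\<And>y j. j \<in> J \<Longrightarrow> \<Phi> (\<Psi> y) j = y j"
  shows "fam_iso I r J s"
  unfolding fam_iso_def using assms by (metis (no_types, lifting) cong_mod_eqI)

lemma fam_iso_sym: "fam_iso I r J s \<Longrightarrow> fam_iso J s I r"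
  unfolding fam_iso_def by blast

lemma lift_hom_cong:
  "lift_hom I r J s \<Phi> \<Longrightarrow> cong_mod I r x y \<Longrightarrow> cong_mod J s (\<Phi> x) (\<Phi> y)"
  unfolding lift_hom_def by blast

lemma lift_hom_add:
  "lift_hom I r J s \<Phi> \<Longrightarrow> cong_mod J s (\<Phi> (\<lambda>i. x i + y i)) (\<lambda>j. \<Phi> x j + \<Phi> y j)"
  unfolding lift_hom_def by blast

lemma lift_hom_smult:
  "lift_hom I r J s \<Phi> \<Longrightarrow> cong_mod J s (\<Phi> (\<lambda>i. x i * c)) (\<lambda>j. \<Phi> x j * c)"
  unfolding lift_hom_def by blast

lemma lift_hom_comp:
  assumes "lift_hom I r J s \<Phi>" "lift_hom J s K t \<Psi>"
  shows "lift_hom I r K t (\<lambda>x. \<Psi> (\<Phi> x))"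
proof -
  note F = assms(1) and G = assms(2)
  show ?thesis
    unfolding lift_hom_def[of I r K t]
    using lift_hom_cong[OF G lift_hom_cong[OF F]]
      cong_mod_trans[OF lift_hom_cong[OF G lift_hom_add[OF F]] lift_hom_add[OF G]]
      cong_mod_trans[OF lift_hom_cong[OF G lift_hom_smult[OF F]] lift_hom_smult[OF G]]
    by simp
qed

lemma fam_iso_trans:
  assumes "fam_iso I r J s" "fam_iso J s K t"
  shows "fam_iso I r K t"
proof -
  obtain F G where 1: "lift_hom I r J s F" "lift_hom J s I r G"
    "\<And>x. cong_mod I r (G (F x)) x" "\<And>y. cong_mod J s (F (G y)) y"
    using assms(1) unfolding fam_iso_def by blast
  obtain F' G' where 2: "lift_hom J s K t F'" "lift_hom K t J s G'"
    "\<And>x. cong_mod J s (G' (F' x)) x" "\<And>y. cong_mod K t (F' (G' y)) y"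
    using assms(2) unfolding fam_iso_def by blast
  have "cong_mod I r (G (G' (F' (F x)))) x" for x
    by (rule cong_mod_trans[OF lift_hom_cong[OF 1(2) 2(3)] 1(3)])
  moreover have "cong_mod K t (F' (F (G (G' y)))) y" for y
    by (rule cong_mod_trans[OF lift_hom_cong[OF 2(1) 1(4)] 2(4)])
  ultimately show ?thesis unfolding fam_iso_def
    using lift_hom_comp[OF 1(1) 2(1)] lift_hom_comp[OF 2(2) 1(2)] by blast
qed

text \<open>Besides renaming indices, the case \<open>g = id\<close> replaces a family by another
  one that agrees with it on the index set.\<close>

lemma fam_iso_reindex:
  assumes "bij_betw g I J" "\<And>i. i \<in> I \<Longrightarrow> r i = s (g i)"
  shows "fam_iso I r J s"
proof -
  let ?h = "inv_into I g"
  have h: "?h j \<in> I" "g (?h j) = j" if "j \<in> J" for j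
    using assms(1) that by (auto simp: bij_betw_def inv_into_into f_inv_into_f)
  have g: "g i \<in> J" "?h (g i) = i" if "i \<in> I" for i
    using assms(1) that by (auto simp: bij_betw_def)
  have "lift_hom I r J s (\<lambda>x j. x (?h j))"
    unfolding lift_hom_def using h assms(2) by (auto simp: cong_mod_refl) (force simp: cong_mod_def)
  moreover have "lift_hom J s I r (\<lambda>y i. y (g i))"
    unfolding lift_hom_def using g assms(2) by (auto simp: cong_mod_refl) (force simp: cong_mod_def)
  moreover have "cong_mod I r (\<lambda>i. x (?h (g i))) x" for x by (rule cong_mod_eqI) (simp add: g)
  moreover have "cong_mod J s (\<lambda>j. y (g (?h j))) y" for y by (rule cong_mod_eqI) (simp add: h)
  ultimately show ?thesis unfolding fam_iso_def by blast
qed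

lemma cong_mod_blocks:
  "cong_mod I r x y \<longleftrightarrow> (\<forall>k. cong_mod {i\<in>I. p i = k} r x y)"
  unfolding cong_mod_def by auto

lemma lift_hom_blocks:
  assumes "\<And>k. lift_hom {i\<in>I. p i = k} r {j\<in>J. q j = k} s (F k)"
  shows "lift_hom I r J s (\<lambda>x j. F (q j) x j)"
proof -
  have a: "cong_mod J s (\<lambda>j. F (q j) x j) (\<lambda>j. F (q j) y j)" if xy: "cong_mod I r x y" for x y
  proof -
    have "cong_mod {j\<in>J. q j = k} s (F k x) (F k y)" for k
      by (rule lift_hom_cong[OF assms]) (use xy in \<open>simp add: cong_mod_def\<close>)
    then show ?thesis unfolding cong_mod_def by auto
  qed
  have b: "cong_mod J s (\<lambda>j. F (q j) (\<lambda>i. x i + y i) j) (\<lambda>j. F (q j) x j + F (q j) y j)" for x y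
  proof -
    have "cong_mod {j\<in>J. q j = k} s (F k (\<lambda>i. x i + y i)) (\<lambda>j. F k x j + F k y j)" for k
      by (rule lift_hom_add[OF assms])
    then show ?thesis unfolding cong_mod_def by auto
  qed
  have c: "cong_mod J s (\<lambda>j. F (q j) (\<lambda>i. x i * c) j) (\<lambda>j. F (q j) x j * c)" for x c
  proof -
    have "cong_mod {j\<in>J. q j = k} s (F k (\<lambda>i. x i * c)) (\<lambda>j. F k x j * c)" for k
      by (rule lift_hom_smult[OF assms])
    then show ?thesis unfolding cong_mod_def by auto
  qed
  show ?thesis unfolding lift_hom_def using a b c by blast
qed

text \<open>Congruence is tested coordinate by coordinate, so isomorphisms between blocks glue with
  no bound on the number or size of the blocks. On block \<open>k\<close> the glued map is congruent
  to \<open>F k\<close>.\<close>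

lemma fam_iso_blocks:
  assumes "\<And>k. fam_iso {i\<in>I. p i = k} r {j\<in>J. q j = k} s"
  shows "fam_iso I r J s"
proof -
  define A where "A k \<Phi> \<Psi> \<longleftrightarrow> lift_hom {i\<in>I. p i = k} r {j\<in>J. q j = k} s \<Phi> \<and>
      lift_hom {j\<in>J. q j = k} s {i\<in>I. p i = k} r \<Psi> \<and>
      (\<forall>x. cong_mod {i\<in>I. p i = k} r (\<Psi> (\<Phi> x)) x) \<and>
      (\<forall>y. cong_mod {j\<in>J. q j = k} s (\<Phi> (\<Psi> y)) y)" for k \<Phi> \<Psi>
  have "\<forall>k. \<exists>\<Phi> \<Psi>. A k \<Phi> \<Psi>"
    using assms unfolding A_def fam_iso_def by simp
  then obtain F G where A: "\<And>k. A k (F k) (G k)" by metis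
  have
    F: "\<And>k. lift_hom {i\<in>I. p i = k} r {j\<in>J. q j = k} s (F k)" and
    G: "\<And>k. lift_hom {j\<in>J. q j = k} s {i\<in>I. p i = k} r (G k)" and
    GF: "\<And>k x. cong_mod {i\<in>I. p i = k} r (G k (F k x)) x" and
    FG: "\<And>k y. cong_mod {j\<in>J. q j = k} s (F k (G k y)) y"
    using A unfolding A_def by simp_all
  define F' where "F' = (\<lambda>x j. F (q j) x j)"
  define G' where "G' = (\<lambda>x j. G (p j) x j)"
  have F': "cong_mod {j\<in>J. q j = k} s (F' x) (F k x)" for k x
    by (rule cong_mod_eqI) (simp add: F'_def)
  have G': "cong_mod {i\<in>I. p i = k} r (G' x) (G k x)" for k x
    by (rule cong_mod_eqI) (simp add: G'_def)
  have "cong_mod I r (G' (F' x)) x" for x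
    unfolding cong_mod_blocks[of I r _ _ p]
    using cong_mod_trans[OF G' cong_mod_trans[OF lift_hom_cong[OF G F'] GF]] by blast
  moreover have "cong_mod J s (F' (G' y)) y" for y
    unfolding cong_mod_blocks[of J s _ _ q]
    using cong_mod_trans[OF F' cong_mod_trans[OF lift_hom_cong[OF F G'] FG]] by blast
  moreover have "lift_hom I r J s F'" "lift_hom J s I r G'"
    unfolding F'_def G'_def using lift_hom_blocks F G by blast+
  ultimately show ?thesis unfolding fam_iso_def by blast
qed

lemma fam_iso_Un:
  assumes "fam_iso I r J s" "fam_iso I' r J' s" "I \<inter> I' = {}" "J \<inter> J' = {}"
  shows "fam_iso (I \<union> I') r (J \<union> J') s"
proof (rule fam_iso_blocks[where p = "\<lambda>i. i \<in> I" and q = "\<lambda>j. j \<in> J"])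
  fix k
  have "{i \<in> I \<union> I'. (i \<in> I) = k} = (if k then I else I')"
    "{j \<in> J \<union> J'. (j \<in> J) = k} = (if k then J else J')" using assms(3,4) by auto
  then show "fam_iso {i \<in> I \<union> I'. (i \<in> I) = k} r {j \<in> J \<union> J'. (j \<in> J) = k} s"
    using assms(1,2) by simp
qed

text \<open>The equation says that left multiplication by \<open>u\<close> carries
  \<open>r i R\<close> into \<open>s j R\<close>; \<open>v\<close> is the induced map on
  relations.\<close>

lemma lift_hom_scale:
  assumes "u * r i = s j * v"
  shows "lift_hom {i} r {j} s (\<lambda>x _. u * x i)"
  unfolding lift_hom_def
proof (intro conjI allI impI)
  fix x y assume "cong_mod {i} r x y"
  then obtain k where "y i = x i + r i * k" unfolding cong_mod_def by blast
  then have "u * y i = u * x i + (u * r i) * k" by (simp add: algebra_simps)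
  then have "u * y i = u * x i + s j * (v * k)" unfolding assms by (simp add: mult.assoc)
  then show "cong_mod {j} s (\<lambda>_. u * x i) (\<lambda>_. u * y i)" unfolding cong_mod_def by blast
qed (rule cong_mod_eqI, simp add: algebra_simps)+

lemma fam_iso_singleton:
  assumes "u \<in> ring_units" "v \<in> ring_units" "u * r i = s j * v"
  shows "fam_iso {i} r {j} s"
proof -
  obtain u' where u': "u' \<in> ring_units" "u * u' = 1" "u' * u = 1" using assms(1) unit_inverse by blast
  obtain v' where v': "v' \<in> ring_units" "v * v' = 1" "v' * v = 1" using assms(2) unit_inverse by blast
  have 1: "u' * s j = r i * v'"
    using assms(3) u' v' by (metis mult.assoc mult_1 mult_1_right)
  have "lift_hom {i} r {j} s (\<lambda>x _. u * x i)" using assms(3) by (rule lift_hom_scale)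
  moreover have "lift_hom {j} s {i} r (\<lambda>x _. u' * x j)" using 1 by (rule lift_hom_scale)
  moreover have "cong_mod {i} r (\<lambda>_. u' * (u * x i)) x" for x
    by (rule cong_mod_eqI) (simp add: u' mult.assoc[symmetric])
  moreover have "cong_mod {j} s (\<lambda>_. u * (u' * x j)) x" for x
    by (rule cong_mod_eqI) (simp add: u' mult.assoc[symmetric])
  ultimately show ?thesis unfolding fam_iso_def by blast
qed

text \<open>The map is a 2 by 2 matrix \<open>P\<close> acting on columns. The hypotheses are the
  entries of \<open>P diag(r i, r i') = diag(s j, s j') Q\<close>, which makes it respect the
  relations.\<close>

lemma lift_hom_pair:
  assumes "i \<noteq> i'" "j \<noteq> j'"
    and "p11 * r i = s j * q11" "p12 * r i' = s j * q12"
    and "p21 * r i = s j' * q21" "p22 * r i' = s j' * q22"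
  shows "lift_hom {i, i'} r {j, j'} s
    (\<lambda>x t. if t = j then p11 * x i + p12 * x i' else p21 * x i + p22 * x i')"
proof -
  have 1: "\<exists>m. p * (a + r i * k) + p' * (a' + r i' * k') = p * a + p' * a' + t * m"
    if "p * r i = t * q" "p' * r i' = t * q'" for p p' a a' k k' t q q'
  proof -
    have "p * (a + r i * k) + p' * (a' + r i' * k') = p * a + p' * a' + ((p * r i) * k + (p' * r i') * k')"
      by (simp add: algebra_simps)
    also have "\<dots> = p * a + p' * a' + t * (q * k + q' * k')"
      unfolding that by (simp add: algebra_simps)
    finally show ?thesis by blast
  qed
  show ?thesis unfolding lift_hom_def
  proof (intro conjI allI impI)
    fix x y assume "cong_mod {i, i'} r x y"
    then obtain k k' where "y i = x i + r i * k" "y i' = x i' + r i' * k'"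
      unfolding cong_mod_def by auto
    then show "cong_mod {j, j'} s (\<lambda>t. if t = j then p11 * x i + p12 * x i' else p21 * x i + p22 * x i')
      (\<lambda>t. if t = j then p11 * y i + p12 * y i' else p21 * y i + p22 * y i')"
      using 1 assms unfolding cong_mod_def by auto
  qed (rule cong_mod_eqI, simp add: algebra_simps)+
qed

text \<open>Indexing by the two truth values frees the statement from ambient index sets and allows
  equal parameters.\<close>

definition pair_iso :: "'a::ring_1 \<Rightarrow> 'a \<Rightarrow> 'a \<Rightarrow> 'a \<Rightarrow> bool" where
  "pair_iso a a' b b' \<longleftrightarrow> fam_iso UNIV (\<lambda>t. if t then a else a') UNIV (\<lambda>t. if t then b else b')"

lemma fam_iso_pairI:
  assumes "pair_iso (r i) (r i') (s j) (s j')" "i \<noteq> i'" "j \<noteq> j'"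
  shows "fam_iso {i, i'} r {j, j'} s"
proof -
  have 1: "fam_iso {i, i'} r UNIV (\<lambda>t. if t then r i else r i')"
    by (rule fam_iso_reindex[where g = "\<lambda>x. x = i"]) (use assms(2) in \<open>auto simp: bij_betw_def inj_on_def\<close>)
  have 2: "fam_iso UNIV (\<lambda>t. if t then s j else s j') {j, j'} s"
    by (rule fam_iso_reindex[where g = "\<lambda>t. if t then j else j'"])
      (use assms(3) in \<open>auto simp: bij_betw_def inj_on_def UNIV_bool\<close>)
  show ?thesis using fam_iso_trans[OF fam_iso_trans[OF 1 assms(1)[unfolded pair_iso_def]] 2] .
qed

lemma pair_iso_swap:
  assumes "pair_iso a a' b b'" shows "pair_iso a a' b' b"
proof -
  have "fam_iso UNIV (\<lambda>t. if t then b else b') UNIV (\<lambda>t. if t then b' else b)"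
    by (rule fam_iso_reindex[where g = Not]) (auto simp: bij_betw_def inj_on_def)
  from fam_iso_trans[OF assms[unfolded pair_iso_def] this] show ?thesis unfolding pair_iso_def .
qed

lemma pair_iso_unit:
  assumes "u \<in> ring_units" "v \<in> ring_units" "u * a = b * v"
  shows "pair_iso a c b c"
proof -
  have "fam_iso ({True} \<union> {False}) (\<lambda>t. if t then a else c) ({True} \<union> {False}) (\<lambda>t. if t then b else c)"
    by (rule fam_iso_Un) (auto intro: fam_iso_singleton[OF assms(1,2)] fam_iso_singleton[OF unit_one unit_one] simp: assms(3))
  moreover have "{True} \<union> {False} = UNIV" by auto
  ultimately show ?thesis unfolding pair_iso_def by simp
qed

section \<open>The exchange property\<close>

text \<open>With \<open>P = (y 1; w q)\<close> and \<open>Q = (v f; z 1)\<close> one has \<open>P diag(a,d) = diag(b,c) Q\<close>;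
  \<open>e'\<close> and \<open>h'\<close> invert the Schur complements of \<open>1\<close> in \<open>P\<close> and \<open>Q\<close>.\<close>

lemma pair_iso_matrix:
  fixes a b c d :: "'a::ring_1"
  assumes ya: "y * a = b * v" and wa: "w * a = c * z" and d: "d = b * f" and c: "q * d = c"
    and e: "(w - q * y) * e' = 1" "e' * (w - q * y) = 1"
    and h: "(v - f * z) * h' = 1" "h' * (v - f * z) = 1"
  shows "pair_iso a d b c"
    and "(1 + y * e' * q) * b = d * (- (z * h'))"
    and "(- (y * e')) * c = d * (1 + z * h' * f)"
proof -
  \<comment> \<open>Eliminating with the entries 1 of \<open>P\<close> and \<open>Q\<close> relates
    the two Schur complements. Inverting them yields \<open>r1\<close> to \<open>r4\<close>, the
    four entries of \<open>P^-1 diag(b,c) = diag(a,d) Q^-1\<close>.\<close>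
  have "(w - q * y) * a = - (q * b) * (v - f * z)"
    using ya wa d c[symmetric] by (simp add: algebra_simps)
  then have "e' * ((w - q * y) * a) * h' = e' * (- (q * b) * (v - f * z)) * h'" by simp
  then have r1: "- (e' * q) * b = a * h'"
    using e(2) h(1) by (metis (no_types, lifting) mult.assoc mult_1 mult_1_right mult_minus_left mult_minus_right)
  have r2: "e' * c = a * (- (h' * f))"
    using r1 c d by (metis minus_mult_minus mult.assoc mult_minus_left mult_minus_right minus_minus)
  have vh: "v * h' = 1 + f * z * h'" using h(1) by (simp add: algebra_simps)
  have "(1 + y * e' * q) * b = b - y * (- (e' * q) * b)" by (simp add: algebra_simps)
  also have "\<dots> = b - (y * a) * h'" unfolding r1 by (simp add: mult.assoc)
  also have "\<dots> = b - b * (v * h')" unfolding ya by (simp add: mult.assoc)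
  also have "\<dots> = d * (- (z * h'))" unfolding vh d by (simp add: algebra_simps)
  finally show r3: "(1 + y * e' * q) * b = d * (- (z * h'))" .
  have "(- (y * e')) * c = (y * a) * h' * f" using r2 by (simp add: mult.assoc)
  also have "\<dots> = b * (v * h') * f" unfolding ya by (simp add: mult.assoc)
  also have "\<dots> = d * (1 + z * h' * f)" unfolding vh d by (simp add: algebra_simps)
  finally show r4: "(- (y * e')) * c = d * (1 + z * h' * f)" .
  have UB: "UNIV = {True, False}" by auto
  let ?r = "\<lambda>t. if t then a else d" and ?s = "\<lambda>t. if t then b else c"
  \<comment> \<open>\<open>F\<close> and \<open>G\<close> are multiplication by \<open>P\<close> and
    by its inverse.\<close>
  define F where "F = (\<lambda>x t. if t = True then y * x True + 1 * x False else w * x True + q * x False)"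
  define G where "G = (\<lambda>x t. if t = True then - (e' * q) * x True + e' * x False
      else (1 + y * e' * q) * x True + (- (y * e')) * x False)"
  have hF: "lift_hom UNIV ?r UNIV ?s F" unfolding UB F_def
    by (rule lift_hom_pair[where ?q11.0 = v and ?q12.0 = f and ?q21.0 = z and ?q22.0 = 1])
      (use ya wa d c in auto)
  have hG: "lift_hom UNIV ?s UNIV ?r G" unfolding UB G_def
    by (rule lift_hom_pair[where ?q11.0 = h' and ?q12.0 = "- (h' * f)"
        and ?q21.0 = "- (z * h')" and ?q22.0 = "1 + z * h' * f"])
      (use r1 r2 r3 r4 in auto)
  have ew: "e' * w = 1 + e' * q * y" and we: "w * e' = 1 + q * y * e'"
    using e by (simp_all add: algebra_simps)
  have GF: "G (F x) t = x t" for x t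
  proof (cases t)
    case True
    have "G (F x) True = (e' * w) * x True - e' * q * y * x True" by (simp add: F_def G_def algebra_simps)
    then show ?thesis unfolding ew using True by (simp add: F_def G_def algebra_simps)
  next
    case False
    have "G (F x) False = x False + y * x True + y * (e' * q * y) * x True - y * (e' * w) * x True"
      by (simp add: F_def G_def algebra_simps)
    then show ?thesis unfolding ew using False by (simp add: F_def G_def algebra_simps)
  qed
  have FG: "F (G x) t = x t" for x t
  proof (cases t)
    case True
    then show ?thesis by (simp add: F_def G_def algebra_simps)
  next
    case False
    have "F (G x) False = (w * e') * x False - (w * e') * q * x True + q * x True
      + q * y * e' * q * x True - q * y * e' * x False"
      by (simp add: F_def G_def algebra_simps)
    then show ?thesis unfolding we using False by (simp add: F_def G_def algebra_simps)
  qed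
  show "pair_iso a d b c" unfolding pair_iso_def by (rule fam_isoI[OF hF hG GF FG])
qed

text \<open>If \<open>y\<close> is a unit, \<open>a\<close> and \<open>b\<close> present isomorphic
  modules and \<open>d = c\<close> works; if \<open>z\<close> is a unit, \<open>d = b\<close> works.
  If neither is, the Schur complements of the matrix construction are units plus nonunits, hence
  units.\<close>

lemma exchange:
  fixes a b c :: "'a::ring_1"
  assumes loc: "local_ring TYPE('a)" and l: "same_lower_part a b" and e: "same_epi_class a c"
  shows "\<exists>d. pair_iso a d b c \<and> same_lower_part d c \<and> same_epi_class d b"
proof -
  obtain u v x y where uv: "u \<in> ring_units" "v \<in> ring_units" "a * u = x * b" "b * v = y * a"
    using l unfolding same_lower_part_def by blast
  obtain w w' z y' where w: "w \<in> ring_units" "w' \<in> ring_units" "w * a = c * z" "w' * c = a * y'"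
    using e unfolding same_epi_class_def by blast
  consider "y \<in> ring_units" | "z \<in> ring_units" | "y \<notin> ring_units" "z \<notin> ring_units" by blast
  then show ?thesis
  proof cases
    case 1
    have ya: "y * a = b * v" using uv by simp
    have "same_epi_class c b"
      using e unit_equivalent_imp_same(2)[OF 1 uv(2) ya] same_epi_class_sym same_epi_class_trans by blast
    then show ?thesis using pair_iso_unit[OF 1 uv(2) ya] same_lower_part_refl by blast
  next
    case 2
    have "same_lower_part b c"
      using l unit_equivalent_imp_same(1)[OF w(1) 2 w(3)] same_lower_part_sym same_lower_part_trans by blast
    moreover have "pair_iso a b b c" using pair_iso_swap[OF pair_iso_unit[OF w(1) 2 w(3)]] .
    ultimately show ?thesis using same_epi_class_refl by blast
  next
    case 3
    obtain u' where u': "u' \<in> ring_units" "u * u' = 1" "u' * u = 1" using uv(1) unit_inverse by blast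
    obtain w1 where w1: "w1 \<in> ring_units" "w' * w1 = 1" "w1 * w' = 1" using w(2) unit_inverse by blast
    \<comment> \<open>The choice gives
      \<open>q * d = w1 * x * b * u' * y' = w1 * a * y' = w1 * w' * c = c\<close>, so that both
      matrices can have an entry 1.\<close>
    define q where "q = - (w1 * x)"
    define f where "f = - (u' * y')"
    define d where "d = b * f"
    have "w1 * (a * (u * u') * y') = c"
      using u' w1 w(4) by (simp add: mult.assoc[symmetric]) (metis mult.assoc mult_1)
    moreover have "q * d = w1 * (x * b) * u' * y'" unfolding q_def d_def f_def by (simp add: mult.assoc)
    ultimately have qd: "q * d = c" unfolding uv(3)[symmetric] by (simp add: mult.assoc)
    have "w - q * y \<in> ring_units"
      using unit_add_nonunit[OF loc w(1), of "w1 * x * y"] 3 unit_mult_iff[OF loc] by (simp add: q_def)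
    then obtain e' where e': "(w - q * y) * e' = 1" "e' * (w - q * y) = 1" using unit_inverse by blast
    have "v - f * z \<in> ring_units"
      using unit_add_nonunit[OF loc uv(2), of "u' * y' * z"] 3 unit_mult_iff[OF loc] by (simp add: f_def)
    then obtain h' where h': "(v - f * z) * h' = 1" "h' * (v - f * z) = 1" using unit_inverse by blast
    note m = pair_iso_matrix[OF uv(4)[symmetric] w(3) d_def qd e' h']
    \<comment> \<open>These units give one half of each class relation for \<open>d\<close>; the
      other halves are \<open>d = b * f\<close> and \<open>q * d = c\<close>, with unit 1.\<close>
    have un: "1 + y * e' * q \<in> ring_units" "1 + z * h' * f \<in> ring_units"
      using unit_add_nonunit[OF loc unit_one] 3 unit_mult_iff[OF loc] by blast+
    have "same_epi_class d b" unfolding same_epi_class_def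
      using m(2) un(1) d_def unit_one by (metis mult_1)
    moreover have "same_lower_part d c" unfolding same_lower_part_def
      using m(3) un(2) qd unit_one by (metis mult_1_right)
    ultimately show ?thesis using m(1) by blast
  qed
qed

text \<open>If neither relation already has units on both sides, their sum does: each side becomes a
  unit plus a nonunit.\<close>

lemma same_classes_fam_iso_singleton:
  assumes loc: "local_ring TYPE('a::ring_1)"
    and "same_lower_part (r i :: 'a) (s j)" "same_epi_class (r i) (s j)"
  shows "fam_iso {i} r {j} s"
proof -
  obtain v y where v: "v \<in> ring_units" "y * r i = s j * v"
    using assms(2) unfolding same_lower_part_def by metis
  obtain w z where w: "w \<in> ring_units" "w * r i = s j * z"
    using assms(3) unfolding same_epi_class_def by blast
  consider "y \<in> ring_units" | "z \<in> ring_units" | "y \<notin> ring_units" "z \<notin> ring_units" by blast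
  then show ?thesis
  proof cases
    case 3
    have "(w + y) * r i = s j * (v + z)" using v w by (simp add: algebra_simps)
    then show ?thesis
      using fam_iso_singleton unit_add_nonunit[OF loc] v(1) w(1) 3 by metis
  qed (use v w fam_iso_singleton in metis)+
qed

section \<open>Finite families\<close>

text \<open>One factor is split off at a time. When \<sigma> and \<tau> differ at \<open>i\<close>,
  exchange trades the two partners of \<open>r i\<close> for \<open>r i\<close> and some
  \<open>d\<close>, and \<open>d\<close> joins the remaining family; hence the induction over all
  \<open>s\<close> and \<tau>.\<close>

lemma finite_families_fam_iso:
  fixes r :: "'i \<Rightarrow> 'a::ring_1" and s :: "'j \<Rightarrow> 'a"
  assumes loc: "local_ring TYPE('a)" and "finite I" "bij_betw \<sigma> I J" "bij_betw \<tau> I J"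
    and "\<forall>i\<in>I. same_lower_part (r i) (s (\<sigma> i))" "\<forall>i\<in>I. same_epi_class (r i) (s (\<tau> i))"
  shows "fam_iso I r J s"
  using assms(2-)
proof (induction I arbitrary: J s \<sigma> \<tau> rule: finite_induct)
  case empty
  then have "J = {}" by (auto simp: bij_betw_def)
  then show ?case by (intro fam_iso_reindex[of \<sigma>]) (use empty in auto)
next
  case (insert i I)
  note bs = insert.prems(1) and bt = insert.prems(2) and lo = insert.prems(3) and ep = insert.prems(4)
  have J: "\<sigma> i \<in> J" "\<tau> i \<in> J" using bs bt by (auto simp: bij_betw_def)
  have bs': "bij_betw \<sigma> I (J - {\<sigma> i})" and bt': "bij_betw \<tau> I (J - {\<tau> i})"
    using bs bt insert.hyps(2) by (auto simp: bij_betw_def inj_on_def)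
  show ?case
  proof (cases "\<sigma> i = \<tau> i")
    case True
    have "fam_iso I r (J - {\<sigma> i}) s"
      using insert.IH[OF bs'] bt' True lo ep by auto
    moreover have "fam_iso {i} r {\<sigma> i} s"
      using same_classes_fam_iso_singleton[OF loc] True lo ep by (metis insertI1)
    ultimately have "fam_iso ({i} \<union> I) r ({\<sigma> i} \<union> (J - {\<sigma> i})) s"
      using insert.hyps(2) by (intro fam_iso_Un) auto
    then show ?thesis using J by (simp add: insert_absorb)
  next
    case False
    obtain d where d: "pair_iso (r i) d (s (\<sigma> i)) (s (\<tau> i))" "same_lower_part d (s (\<tau> i))"
      "same_epi_class d (s (\<sigma> i))"
      using exchange[OF loc] lo ep by (metis insertI1)
    \<comment> \<open>\<open>d\<close> takes the place of \<open>s (\<tau> i)\<close>, whose lower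
      part it has. Its epigeny class is that of the removed \<open>s (\<sigma> i)\<close>, so \<tau>
      is redirected from \<open>\<sigma> i\<close> to \<open>\<tau> i\<close>.\<close>
    define s' where "s' = s(\<tau> i := d)"
    define \<tau>' where "\<tau>' = (\<lambda>k. if \<tau> k = \<sigma> i then \<tau> i else \<tau> k)"
    have "bij_betw \<tau>' I (J - {\<sigma> i})"
    proof -
      have "bij_betw (\<lambda>j. if j = \<sigma> i then \<tau> i else j) (J - {\<tau> i}) (J - {\<sigma> i})"
        using False J by (auto simp: bij_betw_def inj_on_def)
      from bij_betw_trans[OF bt' this] show ?thesis unfolding \<tau>'_def comp_def .
    qed
    moreover have "\<forall>k\<in>I. same_lower_part (r k) (s' (\<sigma> k))"
      using lo d(2) same_lower_part_sym same_lower_part_trans unfolding s'_def by (metis fun_upd_apply insertI2)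
    moreover have "\<forall>k\<in>I. same_epi_class (r k) (s' (\<tau>' k))"
    proof
      fix k assume k: "k \<in> I"
      then have "\<tau> k \<noteq> \<tau> i" using bt' by (auto simp: bij_betw_def)
      moreover have "same_epi_class (r k) (s (\<tau> k))" using ep k by blast
      moreover from this have "same_epi_class (r k) d" if "\<tau> k = \<sigma> i"
        using same_epi_class_trans[OF _ same_epi_class_sym[OF d(3)]] that by simp
      ultimately show "same_epi_class (r k) (s' (\<tau>' k))"
        unfolding s'_def \<tau>'_def by simp
    qed
    ultimately have IH: "fam_iso I r (J - {\<sigma> i}) s'" using insert.IH[OF bs'] by blast
    \<comment> \<open>\<open>t\<close> is \<open>s\<close> with the exchanged pair replaced by
      \<open>r i\<close> and \<open>d\<close>; it links the induction hypothesis to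
      \<open>s\<close>.\<close>
    define t where "t = s'(\<sigma> i := r i)"
    have "fam_iso {i} r {\<sigma> i} t" by (rule fam_iso_reindex[where g = \<sigma>]) (auto simp: t_def)
    moreover have "fam_iso I r (J - {\<sigma> i}) t"
      by (rule fam_iso_trans[OF IH fam_iso_reindex[where g = id]]) (auto simp: t_def)
    ultimately have 1: "fam_iso ({i} \<union> I) r ({\<sigma> i} \<union> (J - {\<sigma> i})) t"
      using insert.hyps(2) by (intro fam_iso_Un) auto
    have "fam_iso {\<sigma> i, \<tau> i} t {\<sigma> i, \<tau> i} s"
      using d(1) False by (intro fam_iso_pairI) (auto simp: t_def s'_def)
    moreover have "fam_iso (J - {\<sigma> i, \<tau> i}) t (J - {\<sigma> i, \<tau> i}) s"
      by (rule fam_iso_reindex[where g = id]) (auto simp: t_def s'_def)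
    ultimately have 2: "fam_iso ({\<sigma> i, \<tau> i} \<union> (J - {\<sigma> i, \<tau> i})) t ({\<sigma> i, \<tau> i} \<union> (J - {\<sigma> i, \<tau> i})) s"
      by (intro fam_iso_Un) auto
    have "{\<sigma> i, \<tau> i} \<union> (J - {\<sigma> i, \<tau> i}) = J" "{\<sigma> i} \<union> (J - {\<sigma> i}) = J" using J by auto
    then show ?thesis using fam_iso_trans[of _ r J t J s] 1 2 by simp
  qed
qed

section \<open>Families indexed by the integers\<close>

text \<open>Both products are isomorphic to the product of a sequence \<open>X\<close> with \<open>X\<^sub>0 = a\<^sub>0\<close>, where
  \<open>X\<^bsub>2k\<^esub>, X\<^bsub>2k+1\<^esub>\<close> replaces \<open>b\<^bsub>-k\<^esub>, b\<^bsub>k+1\<^esub>\<close> and \<open>X\<^bsub>2k+1\<^esub>, X\<^bsub>2k+2\<^esub>\<close> replaces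
  \<open>a\<^bsub>k+1\<^esub>, a\<^bsub>-k-1\<^esub>\<close>.\<close>

lemma int_families_fam_iso:
  fixes a b :: "int \<Rightarrow> 'a::ring_1"
  assumes loc: "local_ring TYPE('a)"
    and lo: "\<And>n. same_lower_part (a n) (b n)" and ep: "\<And>n. same_epi_class (a n) (b (n + 1))"
  shows "fam_iso UNIV a UNIV b"
proof -
  \<comment> \<open>\<open>P\<close> is the invariant of the even terms \<open>g\<close> of the
    sequence: exactly what exchange against \<open>b (- int k)\<close> and
    \<open>b (int k + 1)\<close> requires. In \<open>Q\<close>, \<open>e\<close> is the odd term
    that follows.\<close>
  define P where "P k g \<longleftrightarrow> same_lower_part g (b (- int k)) \<and> same_epi_class g (b (int k + 1))"
    for k g
  define Q where "Q k g e g' \<longleftrightarrow> pair_iso g e (b (- int k)) (b (int k + 1)) \<and>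
      pair_iso e g' (a (int k + 1)) (a (- int k - 1))" for k g e g'
  have step: "\<exists>e g'. Q k g e g' \<and> P (Suc k) g'" if P: "P k g" for k g
  proof -
    obtain e where e: "pair_iso g e (b (- int k)) (b (int k + 1))"
      "same_lower_part e (b (int k + 1))" "same_epi_class e (b (- int k))"
      using exchange[OF loc] P unfolding P_def by blast
    \<comment> \<open>The classes of \<open>e\<close>, given through the \<open>b\<close> family,
      are now read in the \<open>a\<close> family. The shift by one in \<open>ep\<close> moves the
      left end from \<open>- int k\<close> to \<open>- int k - 1\<close>.\<close>
    have "same_lower_part e (a (int k + 1))"
      by (rule same_lower_part_trans[OF e(2) same_lower_part_sym[OF lo]])
    moreover have "same_epi_class e (a (- int k - 1))"
      by (rule same_epi_class_trans[OF e(3) same_epi_class_sym]) (use ep[of "- int k - 1"] in simp)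
    ultimately obtain g' where g': "pair_iso e g' (a (int k + 1)) (a (- int k - 1))"
      "same_lower_part g' (a (- int k - 1))" "same_epi_class g' (a (int k + 1))"
      using exchange[OF loc] by blast
    have eqs: "- int (Suc k) = - int k - 1" "int (Suc k) = int k + 1" by simp_all
    have "same_lower_part g' (b (- int (Suc k)))"
      unfolding eqs(1) by (rule same_lower_part_trans[OF g'(2) lo])
    moreover have "same_epi_class g' (b (int (Suc k) + 1))"
      unfolding eqs(2) by (rule same_epi_class_trans[OF g'(3) ep])
    ultimately show ?thesis using e g' unfolding P_def Q_def by blast
  qed
  have "\<exists>G. \<forall>k. (P k (G k) \<and> (k = 0 \<longrightarrow> G k = a 0)) \<and> (\<exists>e. Q k (G k) e (G (Suc k)))"
  proof (rule dependent_nat_choice)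
    show "\<exists>x. P 0 x \<and> (0 = (0::nat) \<longrightarrow> x = a 0)" using lo[of 0] ep[of 0] unfolding P_def by auto
    show "\<exists>y. (P (Suc k) y \<and> (Suc k = 0 \<longrightarrow> y = a 0)) \<and> (\<exists>e. Q k x e y)"
      if "P k x \<and> (k = 0 \<longrightarrow> x = a 0)" for x k using step that by blast
  qed
  then obtain G E where G0: "G 0 = a 0" and Q: "\<And>k. Q k (G k) (E k) (G (Suc k))" by metis
  define X where "X n = (if even n then G (n div 2) else E (n div 2))" for n
  have "fam_iso UNIV X UNIV b"
  \<comment> \<open>Positions \<open>2 * k\<close> and \<open>2 * k + 1\<close> are paired with the
    integers \<open>- int k\<close> and \<open>int k + 1\<close>.\<close>
  proof (rule fam_iso_blocks[where p = "\<lambda>n. n div 2" and q = "\<lambda>n::int. if n \<le> 0 then nat (- n) else nat (n - 1)"])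
    fix k :: nat
    have "{n \<in> UNIV. n div 2 = k} = {2 * k, 2 * k + 1}" by auto
    moreover have "{n \<in> UNIV. (if n \<le> 0 then nat (- n) else nat (n - 1)) = k} = {- int k, int k + 1}" by auto
    moreover have "fam_iso {2 * k, 2 * k + 1} X {- int k, int k + 1} b"
      using Q[of k] by (intro fam_iso_pairI) (auto simp: X_def Q_def)
    ultimately show "fam_iso {n \<in> UNIV. n div 2 = k} X
        {n \<in> UNIV. (if n \<le> 0 then nat (- n) else nat (n - 1)) = k} b" by simp
  qed
  moreover have "fam_iso UNIV X UNIV a"
  \<comment> \<open>The pairing is shifted by one, so \<open>X 0\<close> stands alone against
    \<open>a 0\<close> and every other block faces the integers of one absolute value.\<close>
  proof (rule fam_iso_blocks[where p = "\<lambda>n. (n + 1) div 2" and q = "\<lambda>n. nat \<bar>n\<bar>"])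
    fix k :: nat
    show "fam_iso {n \<in> UNIV. (n + 1) div 2 = k} X {n \<in> UNIV. nat \<bar>n\<bar> = k} a"
    proof (cases k)
      case 0
      have "{n \<in> UNIV. (n + 1) div 2 = k} = {0}" "{n \<in> UNIV. nat \<bar>n\<bar> = k} = {0}" using 0 by auto
      moreover have "fam_iso {0} X {0} a" by (rule fam_iso_reindex[where g = int]) (auto simp: X_def G0)
      ultimately show ?thesis by simp
    next
      case (Suc m)
      have "{n \<in> UNIV. (n + 1) div 2 = k} = {2 * m + 1, 2 * m + 2}" using Suc by auto
      moreover have "{n \<in> UNIV. nat \<bar>n\<bar> = k} = {int m + 1, - int m - 1}" using Suc by auto
      moreover have "fam_iso {2 * m + 1, 2 * m + 2} X {int m + 1, - int m - 1} a"
        using Q[of m] by (intro fam_iso_pairI) (auto simp: X_def Q_def)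
      ultimately show ?thesis by simp
    qed
  qed
  ultimately show ?thesis by (blast intro: fam_iso_trans[OF fam_iso_sym])
qed

section \<open>Arbitrary families\<close>

text \<open>Integer iterates, so that an infinite orbit is parametrized by all integers; the
  negative ones are meaningful for bijective \<open>f\<close>.\<close>

definition zpow :: "('b \<Rightarrow> 'b) \<Rightarrow> int \<Rightarrow> 'b \<Rightarrow> 'b" where
  "zpow f n = (if n \<ge> 0 then f ^^ nat n else inv f ^^ nat (- n))"

lemma zpow_0: "zpow f 0 x = x"
  by (simp add: zpow_def)

lemma zpow_uminus: "zpow f (- int m) = inv f ^^ m"
  by (cases "m = 0") (simp_all add: zpow_def)

lemma zpow_succ:
  assumes "bij f" shows "zpow f (n + 1) x = f (zpow f n x)"
proof (cases "n \<ge> 0")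
  case True
  then show ?thesis by (simp add: zpow_def nat_add_distrib)
next
  case False
  then obtain m where m: "n = - int (Suc m)"
    by (metis int_cases not_le of_nat_0_le_iff)
  then have "n + 1 = - int m" by simp
  then have "zpow f (n + 1) x = (inv f ^^ m) x" by (simp only: zpow_uminus)
  moreover have "zpow f n x = inv f ((inv f ^^ m) x)" unfolding m zpow_uminus by simp
  ultimately show ?thesis using assms by (simp add: bij_is_surj surj_f_inv_f)
qed

lemma zpow_add:
  assumes "bij f" shows "zpow f (m + n) x = zpow f m (zpow f n x)"
proof (induction m rule: int_induct[where k = 0])
  case base
  show ?case by (simp add: zpow_0)
next
  case (step1 m)
  have "zpow f (m + 1 + n) x = zpow f ((m + n) + 1) x" by (simp add: algebra_simps)
  then show ?case using step1 by (simp only: zpow_succ[OF assms])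
next
  case (step2 m)
  have "f (zpow f (m - 1 + n) x) = zpow f (m + n) x"
    by (simp add: zpow_succ[OF assms, symmetric] algebra_simps)
  also have "\<dots> = f (zpow f (m - 1) (zpow f n x))"
    using step2 by (simp add: zpow_succ[OF assms, symmetric])
  finally show ?case using assms by (simp add: bij_is_inj inj_eq)
qed

lemma zpow_closed:
  assumes "bij f" and inv: "\<And>x. f x \<in> I \<longleftrightarrow> x \<in> I"
  shows "zpow f n x \<in> I \<longleftrightarrow> x \<in> I"
proof (induction n rule: int_induct[where k = 0])
  case base
  show ?case by (simp add: zpow_0)
next
  case (step1 n)
  then show ?case by (simp add: zpow_succ[OF assms(1)] inv)
next
  case (step2 n)
  then show ?case using zpow_succ[OF assms(1), of "n - 1" x] inv[of "zpow f (n - 1) x"] by simp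
qed

text \<open>A repetition yields a positive period \<open>p\<close>, and the orbit is then covered by
  the exponents from 0 to \<open>p - 1\<close>.\<close>

lemma inj_zpow_if_infinite_orbit:
  assumes "bij f" "infinite (range (\<lambda>n. zpow f n x))"
  shows "inj (\<lambda>n. zpow f n x)"
proof (rule ccontr)
  assume "\<not> inj (\<lambda>n. zpow f n x)"
  then obtain m n where "m \<noteq> n" "zpow f m x = zpow f n x" unfolding inj_on_def by blast
  then obtain m n where mn: "m < n" "zpow f m x = zpow f n x" by (metis linorder_neqE)
  define p where "p = n - m"
  have p: "p > 0" using mn by (simp add: p_def)
  have "x = zpow f (- m) (zpow f m x)" by (simp add: zpow_add[OF assms(1), symmetric] zpow_0)
  also have "\<dots> = zpow f p x" unfolding mn(2) by (simp add: zpow_add[OF assms(1), symmetric] p_def)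
  finally have px: "zpow f p x = x" by simp
  have pq: "zpow f (p * q) x = x" for q
  proof (induction q rule: int_induct[where k = 0])
    case base
    show ?case by (simp add: zpow_0)
  next
    case (step1 q)
    have "zpow f (p * (q + 1)) x = zpow f (p * q + p) x" by (simp add: algebra_simps)
    then show ?case using step1 px by (simp only: zpow_add[OF assms(1)])
  next
    case (step2 q)
    have "zpow f (p * q) x = zpow f (p * (q - 1) + p) x" by (simp add: algebra_simps)
    then show ?case using step2 px by (simp only: zpow_add[OF assms(1)])
  qed
  have "zpow f k x = zpow f (k mod p) x" for k
    using zpow_add[OF assms(1), of "k mod p" "p * (k div p)" x] pq by simp
  moreover have "k mod p \<in> {0..<p}" for k using p by simp
  ultimately have "range (\<lambda>n. zpow f n x) \<subseteq> (\<lambda>n. zpow f n x) ` {0..<p}" by blast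
  then show False using assms(2) finite_subset by blast
qed

lemma permuted_families_fam_iso:
  fixes a b :: "'i \<Rightarrow> 'a::ring_1"
  assumes loc: "local_ring TYPE('a)" and bij: "bij \<pi>" and inv: "\<And>i. \<pi> i \<in> I \<longleftrightarrow> i \<in> I"
    and lo: "\<And>i. i \<in> I \<Longrightarrow> same_lower_part (a i) (b i)"
    and ep: "\<And>i. i \<in> I \<Longrightarrow> same_epi_class (a i) (b (\<pi> i))"
  shows "fam_iso I a I b"
proof -
  define orb where "orb i = range (\<lambda>n. zpow \<pi> n i)" for i
  have self: "i \<in> orb i" for i unfolding orb_def using zpow_0 by (metis rangeI)
  have orb_eq: "orb (zpow \<pi> m i) = orb i" for m i
  proof -
    have "orb (zpow \<pi> m i) = (\<lambda>n. zpow \<pi> n i) ` range (\<lambda>n. n + m)"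
      unfolding orb_def image_image by (simp add: zpow_add[OF bij])
    moreover have "range (\<lambda>n. n + m) = UNIV" by (metis diff_add_cancel surjI)
    ultimately show ?thesis unfolding orb_def by simp
  qed
  show ?thesis
  \<comment> \<open>Each orbit serves as the label of its own block. Since \<open>I\<close> is
    stable under \<pi>, a nonempty block is the whole orbit.\<close>
  proof (rule fam_iso_blocks[where p = orb and q = orb])
    fix k
    show "fam_iso {i \<in> I. orb i = k} a {i \<in> I. orb i = k} b"
    proof (cases "{i \<in> I. orb i = k} = {}")
      case True
      show ?thesis unfolding True by (rule fam_iso_reindex[of id]) auto
    next
      case False
      then obtain i where i: "i \<in> I" "orb i = k" by blast
      have K: "{i \<in> I. orb i = k} = k"
      proof
        show "{i \<in> I. orb i = k} \<subseteq> k" using self by blast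
        show "k \<subseteq> {i \<in> I. orb i = k}"
        proof
          fix j assume "j \<in> k"
          then obtain n where n: "j = zpow \<pi> n i" using i unfolding orb_def by blast
          show "j \<in> {i \<in> I. orb i = k}" unfolding n using i zpow_closed[OF bij inv] orb_eq by simp
        qed
      qed
      then have kI: "k \<subseteq> I" by blast
      show ?thesis unfolding K
      proof (cases "finite k")
        case True
        have "\<pi> ` k \<subseteq> k"
        proof
          fix j assume "j \<in> \<pi> ` k"
          then obtain n where "j = \<pi> (zpow \<pi> n i)" using i unfolding orb_def by blast
          then have "j = zpow \<pi> (n + 1) i" by (simp add: zpow_succ[OF bij])
          then show "j \<in> k" using i unfolding orb_def by blast
        qed
        moreover have "inj_on \<pi> k" using bij by (meson bij_is_inj inj_on_subset subset_UNIV)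
        ultimately have "bij_betw \<pi> k k"
          using True by (simp add: bij_betw_def endo_inj_surj)
        moreover have "\<forall>i\<in>k. same_lower_part (a i) (b (id i))" "\<forall>i\<in>k. same_epi_class (a i) (b (\<pi> i))"
          using kI lo ep by auto
        ultimately show "fam_iso k a k b"
          using finite_families_fam_iso[OF loc True bij_betw_id] by blast
      next
        case False
        define g where "g n = zpow \<pi> n i" for n
        have "inj g" unfolding g_def
          by (rule inj_zpow_if_infinite_orbit[OF bij]) (use False i in \<open>simp add: orb_def\<close>)
        moreover have rg: "range g = k" using i unfolding orb_def g_def by simp
        ultimately have g: "bij_betw g UNIV k" by (simp add: bij_betw_def)
        have gI: "g n \<in> I" for n using kI rg by blast
        have "g (n + 1) = \<pi> (g n)" for n unfolding g_def by (rule zpow_succ[OF bij])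
        then have "fam_iso UNIV (\<lambda>n. a (g n)) UNIV (\<lambda>n. b (g n))"
          by (intro int_families_fam_iso[OF loc] lo gI) (simp add: ep gI)
        moreover have "fam_iso k a UNIV (\<lambda>n. a (g n))"
          by (rule fam_iso_sym, rule fam_iso_reindex[OF g]) simp
        moreover have "fam_iso UNIV (\<lambda>n. b (g n)) k b" by (rule fam_iso_reindex[OF g]) simp
        ultimately show "fam_iso k a k b" by (metis fam_iso_trans)
      qed
    qed
  qed
qed

lemma families_fam_iso:
  fixes r :: "'i \<Rightarrow> 'a::ring_1" and s :: "'j \<Rightarrow> 'a"
  assumes loc: "local_ring TYPE('a)" and bs: "bij_betw \<sigma> I J" and bt: "bij_betw \<tau> I J"
    and lo: "\<forall>i\<in>I. same_lower_part (r i) (s (\<sigma> i))" and ep: "\<forall>i\<in>I. same_epi_class (r i) (s (\<tau> i))"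
  shows "fam_iso I r J s"
proof -
  \<comment> \<open>Extending by the identity outside \<open>I\<close> makes \<pi> a bijection of
    the whole type, as its integer iterates require.\<close>
  define \<pi> where "\<pi> i = (if i \<in> I then inv_into I \<sigma> (\<tau> i) else i)" for i
  have "bij_betw (inv_into I \<sigma> \<circ> \<tau>) I I"
    using bij_betw_trans[OF bt bij_betw_inv_into[OF bs]] .
  then have 1: "bij_betw \<pi> I I" by (rule bij_betw_cong[THEN iffD1, rotated]) (simp add: \<pi>_def)
  have 2: "bij_betw \<pi> (- I) (- I)"
    by (rule bij_betw_cong[THEN iffD1, OF _ bij_betw_id]) (simp add: \<pi>_def)
  have "bij \<pi>" using bij_betw_combine[OF 1 2] by (simp add: Compl_partition)
  moreover have "\<pi> i \<in> I \<longleftrightarrow> i \<in> I" for i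
    using 1 by (cases "i \<in> I") (auto simp: \<pi>_def bij_betw_def)
  moreover have "\<sigma> (\<pi> i) = \<tau> i" if "i \<in> I" for i
    using that bij_betwE[OF bt] bij_betw_inv_into_right[OF bs] by (simp add: \<pi>_def)
  ultimately have "fam_iso I r I (\<lambda>i. s (\<sigma> i))"
    using lo ep by (intro permuted_families_fam_iso[OF loc, of \<pi>]) auto
  moreover have "fam_iso I (\<lambda>i. s (\<sigma> i)) J s" by (rule fam_iso_reindex[OF bs]) simp
  ultimately show ?thesis by (rule fam_iso_trans)
qed

section \<open>Cyclically presented modules\<close>

lemma rcoset_eq_iff: "rcoset r x = rcoset r y \<longleftrightarrow> (\<exists>k. y = x + r * k)"
proof
  assume "rcoset r x = rcoset r y"
  moreover have "y + r * 0 \<in> rcoset r y" unfolding rcoset_def by blast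
  ultimately have "y \<in> rcoset r x" by simp
  then show "\<exists>k. y = x + r * k" unfolding rcoset_def by blast
next
  assume "\<exists>k. y = x + r * k"
  then obtain k where k: "y = x + r * k" by blast
  have "x + r * m = y + r * (m - k)" "y + r * m = x + r * (k + m)" for m
    using k by (simp_all add: algebra_simps)
  then show "rcoset r x = rcoset r y" unfolding rcoset_def by blast
qed

lemma cyc_module_carrier: "mcarrier (cyc_module r) = range (rcoset r)"
  unfolding cyc_module_def by auto

lemma cyc_module_add: "madd (cyc_module r) (rcoset r x) (rcoset r y) = rcoset r (x + y)"
proof -
  have "x + r * k + (y + r * l) = (x + y) + r * (k + l)"
    "(x + y) + r * k = (x + r * k) + (y + r * 0)" for k l by (simp_all add: algebra_simps)
  then have "{a + b | a b. a \<in> rcoset r x \<and> b \<in> rcoset r y} = rcoset r (x + y)"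
    unfolding rcoset_def by blast
  then show ?thesis by (simp add: cyc_module_def)
qed

lemma cyc_module_smult: "msmult (cyc_module r) (rcoset r x) c = rcoset r (x * c)"
proof -
  have "(x + r * k) * c + r * l = x * c + r * (k * c + l)"
    "x * c + r * k = (x + r * 0) * c + r * k" for k l by (simp_all add: algebra_simps)
  then have "{a * c + r * y | a y. a \<in> rcoset r x} = rcoset r (x * c)"
    unfolding rcoset_def by blast
  then show ?thesis by (simp add: cyc_module_def)
qed

text \<open>An epimorphism is left multiplication by a lift \<open>w\<close> of the image of the
  coset of 1. Surjectivity puts some \<open>w * y\<close> in \<open>1 + s R\<close>, outside
  \<open>jacobson\<close> because \<open>s\<close> is inside, so \<open>w\<close> is a unit.\<close>

lemma cyc_module_epi_lift:
  fixes r s :: "'a::ring_1"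
  assumes loc: "local_ring TYPE('a)" and s: "s \<in> jacobson"
    and f: "rmod_epi (cyc_module r) (cyc_module s) f"
  shows "\<exists>u\<in>ring_units. \<exists>x. u * r = s * x"
proof -
  have hom: "rmod_hom (cyc_module r) (cyc_module s) f" and surj: "f ` range (rcoset r) = range (rcoset s)"
    using f unfolding rmod_epi_def cyc_module_carrier by auto
  obtain w where w: "f (rcoset r 1) = rcoset s w" using surj by blast
  have fx: "f (rcoset r x) = rcoset s (w * x)" for x
  proof -
    have "f (msmult (cyc_module r) (rcoset r 1) x) = msmult (cyc_module s) (f (rcoset r 1)) x"
      using hom unfolding rmod_hom_def cyc_module_carrier by blast
    then show ?thesis unfolding w cyc_module_smult by simp
  qed
  have "rcoset r 0 = rcoset r r" unfolding rcoset_eq_iff by (metis add_0 mult_1_right)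
  then have "rcoset s (w * 0) = rcoset s (w * r)" using fx by metis
  then obtain x where x: "w * r = s * x" unfolding rcoset_eq_iff by auto
  obtain y where "rcoset s 1 = rcoset s (w * y)" using surj fx by (metis imageE rangeI)
  then obtain k where k: "w * y = 1 + s * k" unfolding rcoset_eq_iff by blast
  have "w \<in> ring_units"
  proof (rule ccontr)
    assume "w \<notin> ring_units"
    then have "w * y \<in> jacobson" "- (s * k) \<in> jacobson"
      using s local_ring_units_iff[OF loc] jacobson_right_ideal(1)[OF loc] unfolding right_ideal_def by blast+
    then have "w * y + - (s * k) \<in> jacobson"
      using jacobson_right_ideal(1)[OF loc] unfolding right_ideal_def by blast
    then show False using k jacobson_right_ideal(2)[OF loc] by simp
  qed
  then show ?thesis using x by blast
qed

lemma same_epigeny_imp_same_epi_class: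
  fixes r s :: "'a::ring_1"
  assumes "local_ring TYPE('a)" "r \<in> jacobson" "s \<in> jacobson"
    and "same_epigeny (cyc_module r) (cyc_module s)"
  shows "same_epi_class r s"
  using assms cyc_module_epi_lift unfolding same_epigeny_def same_epi_class_def by meson

text \<open>The restriction to \<open>I\<close> matches the extensional functions in the carrier of
  \<open>prod_module\<close>.\<close>

definition coset_fam :: "'i set \<Rightarrow> ('i \<Rightarrow> 'a::ring_1) \<Rightarrow> ('i \<Rightarrow> 'a) \<Rightarrow> 'i \<Rightarrow> 'a set" where
  "coset_fam I r x = (\<lambda>i\<in>I. rcoset (r i) (x i))"

lemma coset_fam_eq_iff: "coset_fam I r x = coset_fam I r y \<longleftrightarrow> cong_mod I r x y"
  unfolding coset_fam_def cong_mod_def rcoset_eq_iff[symmetric] restrict_def fun_eq_iff by auto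

lemma prod_cyc_module_carrier:
  "mcarrier (prod_module I (\<lambda>i. cyc_module (r i))) = range (coset_fam I r)"
proof -
  have "X \<in> range (coset_fam I r)" if X: "X \<in> PiE I (\<lambda>i. range (rcoset (r i)))" for X
  proof -
    have "\<forall>i\<in>I. \<exists>t. X i = rcoset (r i) t" using X by (auto simp: PiE_iff)
    then obtain x where x: "\<forall>i\<in>I. X i = rcoset (r i) (x i)" by (rule bchoice[THEN exE])
    have "X = coset_fam I r x"
      by (rule PiE_ext[OF X]) (use x in \<open>auto simp: coset_fam_def\<close>)
    then show ?thesis by blast
  qed
  then show ?thesis
    unfolding prod_module_def by (auto simp: cyc_module_carrier coset_fam_def)
qed

lemma prod_cyc_module_add:
  "madd (prod_module I (\<lambda>i. cyc_module (r i))) (coset_fam I r x) (coset_fam I r y)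
    = coset_fam I r (\<lambda>i. x i + y i)"
  unfolding prod_module_def coset_fam_def by (simp add: cyc_module_add cong: restrict_cong)

lemma prod_cyc_module_smult:
  "msmult (prod_module I (\<lambda>i. cyc_module (r i))) (coset_fam I r x) c = coset_fam I r (\<lambda>i. x i * c)"
  unfolding prod_module_def coset_fam_def by (simp add: cyc_module_smult cong: restrict_cong)

text \<open>The induced map picks a representative with \<open>inv\<close>; respecting congruence
  makes the choice immaterial.\<close>

lemma lift_hom_descends:
  assumes "lift_hom I r J s \<Phi>"
  shows "\<exists>f. \<forall>x. f (coset_fam I r x) = coset_fam J s (\<Phi> x)"
proof (intro exI allI)
  fix x
  have "coset_fam I r (inv (coset_fam I r) (coset_fam I r x)) = coset_fam I r x"
    by (rule f_inv_into_f[where f = "coset_fam I r"]) simp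
  then show "(\<lambda>X. coset_fam J s (\<Phi> (inv (coset_fam I r) X))) (coset_fam I r x) = coset_fam J s (\<Phi> x)"
    using lift_hom_cong[OF assms] unfolding coset_fam_eq_iff by simp
qed

lemma fam_iso_imp_rmod_iso:
  assumes "fam_iso I r J s"
  shows "rmod_iso_exists (prod_module I (\<lambda>i. cyc_module (r i))) (prod_module J (\<lambda>j. cyc_module (s j)))"
proof -
  obtain F G where F: "lift_hom I r J s F" and G: "lift_hom J s I r G"
    and GF: "\<And>x. cong_mod I r (G (F x)) x" and FG: "\<And>y. cong_mod J s (F (G y)) y"
    using assms unfolding fam_iso_def by blast
  obtain f where f: "\<And>x. f (coset_fam I r x) = coset_fam J s (F x)"
    using lift_hom_descends[OF F] by blast
  obtain g where g: "\<And>x. g (coset_fam J s x) = coset_fam I r (G x)"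
    using lift_hom_descends[OF G] by blast
  have "rmod_hom (prod_module I (\<lambda>i. cyc_module (r i))) (prod_module J (\<lambda>j. cyc_module (s j))) f"
    unfolding rmod_hom_def prod_cyc_module_carrier
    by (auto simp: prod_cyc_module_add prod_cyc_module_smult f coset_fam_eq_iff
        intro!: lift_hom_add[OF F] lift_hom_smult[OF F] rangeI)
  moreover have "bij_betw f (range (coset_fam I r)) (range (coset_fam J s))"
    by (rule bij_betw_byWitness[where f' = g]) (auto simp: f g coset_fam_eq_iff GF FG intro!: rangeI)
  ultimately show ?thesis unfolding rmod_iso_exists_def prod_cyc_module_carrier by blast
qed

theorem theorem3p5:
  fixes r :: "'i \<Rightarrow> 'a::ring_1" and s :: "'j \<Rightarrow> 'a"
    and I :: "'i set" and J :: "'j set"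
    and \<sigma> \<tau> :: "'i \<Rightarrow> 'j"
  assumes "local_ring TYPE('a)"
    and "\<forall>i\<in>I. r i \<in> jacobson - {0}"
    and "\<forall>j\<in>J. s j \<in> jacobson - {0}"
    and "bij_betw \<sigma> I J" and "bij_betw \<tau> I J"
    and "\<forall>i\<in>I. same_lower_part (r i) (s (\<sigma> i))"
    and "\<forall>i\<in>I. same_epigeny (cyc_module (r i)) (cyc_module (s (\<tau> i)))"
  shows "rmod_iso_exists (prod_module I (\<lambda>i. cyc_module (r i)))
                         (prod_module J (\<lambda>j. cyc_module (s j)))"
proof -
  have "same_epi_class (r i) (s (\<tau> i))" if "i \<in> I" for i
  proof -
    have "\<tau> i \<in> J" using assms(5) that by (auto simp: bij_betw_def)
    then show ?thesis
      using same_epigeny_imp_same_epi_class[OF assms(1)] assms(2,3,7) that by blast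
  qed
  then show ?thesis
    using families_fam_iso[OF assms(1,4,5,6)] fam_iso_imp_rmod_iso by blast
qed

end
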